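(* Let $(X,\Sigma)$ be a measurable space and let $\mu,\rho$ be probability measures on $(X^\infty,\Sigma^\infty)$. Then for every $t\in[0,1]$, $$H^{ip}(t\mu+(1-t)\rho)\leq t\,H^{ip}(\mu)+(1-t)\,H^{ip}(\rho).$$
   Context: Let $(X,\Sigma)$ be a measurable space; $X^\infty=\prod_{n=0}^\infty X$ carries the product $\sigma$-algebra $\Sigma^\infty$. A partition of a measurable space is a finite collection of pairwise disjoint measurable sets whose union is the whole space. For a probability measure $\nu$ and a partition $\mathcal{P}=\{A_i\}_{i=1}^k$, the Shannon entropy is $H^{sh}(\nu,\mathcal{P})=-\sum_{i=1}^k\nu(A_i)\log\nu(A_i)$ (with $0\log 0=0$). For $A_0,\ldots,A_{n-1}\in\Sigma$ put $\overline{A_0\cdots A_{n-1}}=A_0\times\cdots\times A_{n-1}\times X\times X\times\cdots\subseteq X^\infty$; for a partition $\mathcal{P}=\{A_i\}_{i\in I}$ of $X$ let $\overline{\mathcal{P}}^n=\{\overline{A_{i_0}\cdots A_{i_{n-1}}}:i_0,\ldots,i_{n-1}\in I\}$, a partition of $X^\infty$. For a probability measure $\mu$ on $(X^\infty,\Sigma^\infty)$, the infinite-product entropy is defined by $H^{ip}(\mu,\mathcal{P})=\limsup_{n\to\infty}\frac1n H^{sh}(\mu,\overline{\mathcal{P}}^n)$ and $H^{ip}(\mu)=\sup_{\mathcal{P}}H^{ip}(\mu,\mathcal{P})\in[0,\infty]$, the supremum over all partitions $\mathcal{P}$ of $X$. (Convention: $0\cdot\infty=0$.) *)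

theory Defs
  imports "HOL-Probability.Probability"
begin

definition finite_partition :: "'a measure \<Rightarrow> 'a set set \<Rightarrow> bool" where
  "finite_partition M P \<longleftrightarrow> finite P \<and> P \<subseteq> sets M \<and> disjoint P \<and> \<Union>P = space M"

text \<open>The logarithm is the natural one; \<open>0 * ln 0 = 0\<close> in HOL.\<close>

definition shannon_entropy :: "'a measure \<Rightarrow> 'a set set \<Rightarrow> real" where
  "shannon_entropy \<nu> P = - (\<Sum>A\<in>P. measure \<nu> A * ln (measure \<nu> A))"

text \<open>A measurable space is given by a \<open>measure\<close> \<open>M\<close> of which only the carrier and the
  \<open>\<sigma>\<close>-algebra matter.\<close>

abbreviation seq_space :: "'a measure \<Rightarrow> (nat \<Rightarrow> 'a) measure" where
  "seq_space M \<equiv> (\<Pi>\<^sub>M n\<in>(UNIV::nat set). M)"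

definition cylinder :: "'a measure \<Rightarrow> nat \<Rightarrow> (nat \<Rightarrow> 'a set) \<Rightarrow> (nat \<Rightarrow> 'a) set" where
  "cylinder M n A = (\<Pi>\<^sub>E i\<in>UNIV. if i < n then A i else space M)"

definition cylinder_partition ::
  "'a measure \<Rightarrow> 'a set set \<Rightarrow> nat \<Rightarrow> (nat \<Rightarrow> 'a) set set" where
  "cylinder_partition M P n = {cylinder M n A | A. \<forall>i<n. A i \<in> P}"

definition ip_entropy_partition ::
  "'a measure \<Rightarrow> (nat \<Rightarrow> 'a) measure \<Rightarrow> 'a set set \<Rightarrow> ereal" where
  "ip_entropy_partition M \<mu> P =
     limsup (\<lambda>n. ereal (1 / real n * shannon_entropy \<mu> (cylinder_partition M P n)))"

text \<open>The trivial partition contributes \<open>0\<close>, so for a probability measure the value lies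
  in \<open>[0, \<infinity>]\<close>.\<close>

definition ip_entropy :: "'a measure \<Rightarrow> (nat \<Rightarrow> 'a) measure \<Rightarrow> ereal" where
  "ip_entropy M \<mu> = (SUP P\<in>{P. finite_partition M P}. ip_entropy_partition M \<mu> P)"

definition convex_mix :: "real \<Rightarrow> 'a measure \<Rightarrow> 'a measure \<Rightarrow> 'a measure" where
  "convex_mix t \<mu> \<rho> = measure_of (space \<mu>) (sets \<mu>)
     (\<lambda>A. ennreal t * emeasure \<mu> A + ennreal (1 - t) * emeasure \<rho> A)"

lemma space_convex_mix [simp]: "space (convex_mix t \<mu> \<rho>) = space \<mu>"
  and sets_convex_mix [simp, measurable_cong]: "sets (convex_mix t \<mu> \<rho>) = sets \<mu>"
  by (simp_all add: convex_mix_def)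

lemma emeasure_convex_mix:
  assumes "sets \<rho> = sets \<mu>" and A: "A \<in> sets \<mu>"
  shows "emeasure (convex_mix t \<mu> \<rho>) A
    = ennreal t * emeasure \<mu> A + ennreal (1 - t) * emeasure \<rho> A"
proof (rule emeasure_measure_of[OF convex_mix_def])
  show "sets \<mu> \<subseteq> Pow (space \<mu>)" by (rule sets.space_closed)
  show "A \<in> sets (convex_mix t \<mu> \<rho>)" using A by simp
  show "positive (sets (convex_mix t \<mu> \<rho>))
      (\<lambda>A. ennreal t * emeasure \<mu> A + ennreal (1 - t) * emeasure \<rho> A)"
    by (simp add: positive_def)
  show "countably_additive (sets (convex_mix t \<mu> \<rho>))
      (\<lambda>A. ennreal t * emeasure \<mu> A + ennreal (1 - t) * emeasure \<rho> A)"
  proof (rule countably_additiveI)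
    fix F :: "nat \<Rightarrow> 'a set"
    assume F: "range F \<subseteq> sets (convex_mix t \<mu> \<rho>)" "disjoint_family F"
    have "(\<Sum>i. emeasure \<mu> (F i)) = emeasure \<mu> (\<Union>i. F i)"
      and "(\<Sum>i. emeasure \<rho> (F i)) = emeasure \<rho> (\<Union>i. F i)"
      using F assms(1) by (auto intro!: suminf_emeasure)
    then show "(\<Sum>i. ennreal t * emeasure \<mu> (F i) + ennreal (1 - t) * emeasure \<rho> (F i))
        = ennreal t * emeasure \<mu> (\<Union>i. F i) + ennreal (1 - t) * emeasure \<rho> (\<Union>i. F i)"
      by (simp add: suminf_add[symmetric] ennreal_suminf_cmult)
  qed
qed

lemma prob_space_convex_mix:
  assumes "prob_space \<mu>" "prob_space \<rho>" "sets \<rho> = sets \<mu>" "0 \<le> t" "t \<le> 1"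
  shows "prob_space (convex_mix t \<mu> \<rho>)"
proof (rule prob_spaceI)
  have "space \<rho> = space \<mu>" using assms(3) by (rule sets_eq_imp_space_eq)
  then have "emeasure (convex_mix t \<mu> \<rho>) (space \<mu>) = ennreal t * 1 + ennreal (1 - t) * 1"
    using emeasure_convex_mix[OF assms(3) sets.top]
      prob_space.emeasure_space_1[OF assms(1)] prob_space.emeasure_space_1[OF assms(2)] by simp
  also have "\<dots> = 1" using assms(4,5) by (simp flip: ennreal_plus)
  finally show "emeasure (convex_mix t \<mu> \<rho>) (space (convex_mix t \<mu> \<rho>)) = 1" by simp
qed

end

theory Submission
  imports Defs
begin

text \<open>For a single partition, Shannon entropy is almost affine in the measure: mixing raises the
  entropy above the corresponding convex combination by at most the binary entropy
  \<open>- t ln t - (1 - t) ln (1 - t)\<close>, because \<open>x \<mapsto> - x ln x\<close> is subadditive. This error does not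
  depend on the partition, so division by \<open>n\<close> removes it in the limit.\<close>

text \<open>Monotonicity of \<open>ln\<close> gives x ln x \<le> x ln (x + y) and y ln y \<le> y ln
  (x + y); adding the two gives the claim.\<close>

lemma neg_mult_ln_subadd:
  fixes x y :: real
  assumes "0 \<le> x" "0 \<le> y"
  shows "- ((x + y) * ln (x + y)) \<le> - (x * ln x) - y * ln y"
proof -
  \<comment> \<open>Comparing the logarithms requires a positive argument; at \<open>a = 0\<close>
    both sides vanish because of the outer factor.\<close>
  have *: "a * ln a \<le> a * ln (a + b)" if "0 \<le> a" "0 \<le> b" for a b :: real
    using that by (cases "a = 0") (auto intro!: mult_left_mono)
  show ?thesis
    using *[of x y] *[of y x] assms by (simp add: algebra_simps)
qed

text \<open>For positive factors this is ln (t a) = ln t + ln a; if a factor is zero, both sides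
  vanish. It separates the mixing weight from the probability of a cell.\<close>

lemma mult_ln_mult:
  fixes t a :: real
  assumes "0 \<le> t" "0 \<le> a"
  shows "t * a * ln (t * a) = t * (a * ln a) + a * (t * ln t)"
  using assms by (cases "t = 0 \<or> a = 0") (auto simp: ln_mult algebra_simps)

lemma measure_convex_mix:
  assumes "finite_measure \<mu>" "finite_measure \<rho>" "sets \<rho> = sets \<mu>" "0 \<le> t" "t \<le> 1"
    and "A \<in> sets \<mu>"
  shows "measure (convex_mix t \<mu> \<rho>) A = t * measure \<mu> A + (1 - t) * measure \<rho> A"
proof -
  have "emeasure (convex_mix t \<mu> \<rho>) A
      = ennreal (t * measure \<mu> A + (1 - t) * measure \<rho> A)"
    using assms by (simp add: emeasure_convex_mix finite_measure.emeasure_eq_measure ennreal_mult')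
  then show ?thesis
    using assms(4,5) by (simp add: measure_eq_emeasure_eq_ennreal)
qed

lemma (in prob_space) sum_prob_disjoint_le_1:
  assumes "finite Q" "Q \<subseteq> events" "disjoint Q"
  shows "(\<Sum>A\<in>Q. prob A) \<le> 1"
proof -
  have "(\<Sum>A\<in>Q. prob A) = prob (\<Union>A\<in>Q. A)"
    using assms by (intro finite_measure_finite_Union[symmetric])
      (auto simp: disjoint_family_on_def disjoint_def)
  then show ?thesis by simp
qed

text \<open>Subadditivity splits each cell into a \<mu>-term and a \<rho>-term, and the product rule
  isolates the logarithms of the weights. Summed over \<open>Q\<close>, these are multiplied only by
  the total masses of \<open>Q\<close>, so the error is bounded independently of the number of
  cells.\<close>

lemma shannon_entropy_convex_mix_le:
  assumes "prob_space \<mu>" "prob_space \<rho>" "sets \<rho> = sets \<mu>" "0 \<le> t" "t \<le> 1"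
    and Q: "finite Q" "Q \<subseteq> sets \<mu>" "disjoint Q"
  shows "shannon_entropy (convex_mix t \<mu> \<rho>) Q
    \<le> t * shannon_entropy \<mu> Q + (1 - t) * shannon_entropy \<rho> Q
      + (- (t * ln t) - (1 - t) * ln (1 - t))"
proof -
  interpret \<mu>: prob_space \<mu> by fact
  interpret \<rho>: prob_space \<rho> by fact
  let ?m = "measure \<mu>" and ?r = "measure \<rho>"
  have "shannon_entropy (convex_mix t \<mu> \<rho>) Q
      = (\<Sum>A\<in>Q. - ((t * ?m A + (1 - t) * ?r A) * ln (t * ?m A + (1 - t) * ?r A)))"
    unfolding shannon_entropy_def sum_negf[symmetric]
    using Q assms(3-5) \<mu>.finite_measure_axioms \<rho>.finite_measure_axioms
    by (intro sum.cong refl) (auto simp: measure_convex_mix)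
  also have "\<dots> \<le> (\<Sum>A\<in>Q. - (t * ?m A * ln (t * ?m A))
      - (1 - t) * ?r A * ln ((1 - t) * ?r A))"
    using assms(4,5) by (intro sum_mono neg_mult_ln_subadd) auto
  also have "\<dots> = (\<Sum>A\<in>Q. t * - (?m A * ln (?m A)) + (1 - t) * - (?r A * ln (?r A))
      + ?m A * - (t * ln t) + ?r A * - ((1 - t) * ln (1 - t)))"
    using assms(4,5) by (intro sum.cong refl) (simp add: mult_ln_mult)
  also have "\<dots> = t * shannon_entropy \<mu> Q + (1 - t) * shannon_entropy \<rho> Q
      + (\<Sum>A\<in>Q. ?m A) * - (t * ln t) + (\<Sum>A\<in>Q. ?r A) * - ((1 - t) * ln (1 - t))"
    by (simp only: sum.distrib sum_distrib_left[symmetric] sum_distrib_right[symmetric]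
        sum_negf shannon_entropy_def)
  also have "\<dots> \<le> t * shannon_entropy \<mu> Q + (1 - t) * shannon_entropy \<rho> Q
      + 1 * - (t * ln t) + 1 * - ((1 - t) * ln (1 - t))"
  proof -
    \<comment> \<open>Both error coefficients are nonnegative, so total masses at most 1 can be
      replaced by 1.\<close>
    have neg: "0 \<le> - (s * ln s)" if "0 \<le> s" "s \<le> 1" for s :: real
      using that by (cases "s = 0") (auto simp: mult_nonneg_nonpos)
    show ?thesis
      using \<mu>.sum_prob_disjoint_le_1[OF Q] \<rho>.sum_prob_disjoint_le_1[of Q] Q assms(3-5)
      by (intro add_mono[OF add_mono[OF order_refl]] mult_right_mono neg) auto
  qed
  finally show ?thesis by simp
qed

lemma cylinder_in_sets:
  assumes "\<And>i. i < n \<Longrightarrow> A i \<in> sets M"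
  shows "cylinder M n A \<in> sets (seq_space M)"
  unfolding cylinder_def using assms by (intro sets_PiM_I_countable) auto

text \<open>A cylinder depends only on the first \<open>n\<close> entries of \<open>A\<close>, so
  the finitely many extensional functions from \<open>{..<n}\<close> to \<open>P\<close> already
  produce every cylinder.\<close>

lemma finite_cylinder_partition:
  assumes "finite P"
  shows "finite (cylinder_partition M P n)"
proof (rule finite_subset)
  show "cylinder_partition M P n \<subseteq> cylinder M n ` ({..<n} \<rightarrow>\<^sub>E P)"
  proof
    fix B assume "B \<in> cylinder_partition M P n"
    then obtain A where A: "B = cylinder M n A" "\<forall>i<n. A i \<in> P"
      by (auto simp: cylinder_partition_def)
    then have "B = cylinder M n (restrict A {..<n})"
      by (auto simp: cylinder_def intro!: PiE_cong)
    with A show "B \<in> cylinder M n ` ({..<n} \<rightarrow>\<^sub>E P)" by auto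
  qed
  show "finite (cylinder M n ` ({..<n} \<rightarrow>\<^sub>E P))"
    using assms by (intro finite_imageI finite_PiE) auto
qed

text \<open>A common point \<open>x\<close> has \<open>x i\<close> in both i-th cells for each
  \<open>i < n\<close>. Disjointness of \<open>P\<close> makes these cells equal, so the two
  cylinders coincide.\<close>

lemma disjoint_cylinder_partition:
  assumes "disjoint P"
  shows "disjoint (cylinder_partition M P n)"
proof (rule disjointI)
  fix B C assume "B \<in> cylinder_partition M P n" "C \<in> cylinder_partition M P n" "B \<noteq> C"
  then obtain A A' where A: "B = cylinder M n A" "C = cylinder M n A'"
      "\<And>i. i < n \<Longrightarrow> A i \<in> P" "\<And>i. i < n \<Longrightarrow> A' i \<in> P"
    by (auto simp: cylinder_partition_def)
  have False if x: "x \<in> B" "x \<in> C" for x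
  proof -
    have "A i = A' i" if i: "i < n" for i
    proof -
      have "x i \<in> A i" "x i \<in> A' i"
        using x A(1,2) i by (auto simp: cylinder_def PiE_iff split: if_splits)
      with disjointD[OF assms A(3)[OF i] A(4)[OF i]] show ?thesis by auto
    qed
    with A(1,2) \<open>B \<noteq> C\<close> show False
      by (auto simp: cylinder_def cong: if_cong)
  qed
  then show "B \<inter> C = {}" by blast
qed

lemma cylinder_partition_subset_sets:
  assumes "P \<subseteq> sets M"
  shows "cylinder_partition M P n \<subseteq> sets (seq_space M)"
  using assms by (auto simp: cylinder_partition_def intro!: cylinder_in_sets)

text \<open>The case \<open>c = 0\<close> is consistent with an infinite limsup, since 0 times an
  infinite value is 0 in \<open>ereal\<close>.\<close>

lemma limsup_ereal_cmult:
  assumes "0 \<le> c"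
  shows "limsup (\<lambda>n. ereal c * f n) = ereal c * limsup f"
  using assms by (intro Limsup_ereal_mult_left) auto

lemma ip_entropy_partition_convex_mix_le:
  assumes "prob_space \<mu>" "sets \<mu> = sets (seq_space M)"
    and "prob_space \<rho>" "sets \<rho> = sets (seq_space M)"
    and "0 \<le> t" "t \<le> 1" and P: "finite_partition M P"
  shows "ip_entropy_partition M (convex_mix t \<mu> \<rho>) P
    \<le> ereal t * ip_entropy_partition M \<mu> P + ereal (1 - t) * ip_entropy_partition M \<rho> P"
proof -
  define c where "c = - (t * ln t) - (1 - t) * ln (1 - t)"
  define h where "h \<nu> n = 1 / real n * shannon_entropy \<nu> (cylinder_partition M P n)" for \<nu> n
  have ip: "ip_entropy_partition M \<nu> P = limsup (\<lambda>n. ereal (h \<nu> n))" for \<nu>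
    by (simp add: ip_entropy_partition_def h_def)
  \<comment> \<open>This also holds at \<open>n = 0\<close>: division by zero yields 0, so both
    sides are 0.\<close>
  have le: "h (convex_mix t \<mu> \<rho>) n \<le> t * h \<mu> n + (1 - t) * h \<rho> n + c / real n" for n
  proof -
    have "shannon_entropy (convex_mix t \<mu> \<rho>) (cylinder_partition M P n)
        \<le> t * shannon_entropy \<mu> (cylinder_partition M P n)
          + (1 - t) * shannon_entropy \<rho> (cylinder_partition M P n) + c"
      unfolding c_def using assms cylinder_partition_subset_sets[of P M n]
      by (intro shannon_entropy_convex_mix_le finite_cylinder_partition
          disjoint_cylinder_partition) (auto simp: finite_partition_def)
    from mult_left_mono[OF this, of "1 / real n"] show ?thesis
      by (simp add: h_def algebra_simps add_divide_distrib diff_divide_distrib)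
  qed
  have c0: "limsup (\<lambda>n. ereal (c / real n)) = 0"
  proof (rule lim_imp_Limsup)
    show "(\<lambda>n. ereal (c / real n)) \<longlonglongrightarrow> 0"
      unfolding zero_ereal_def by (intro tendsto_ereal lim_const_over_n)
  qed simp
  have "limsup (\<lambda>n. ereal (h (convex_mix t \<mu> \<rho>) n))
      \<le> limsup (\<lambda>n. (ereal t * ereal (h \<mu> n) + ereal (1 - t) * ereal (h \<rho> n))
          + ereal (c / real n))"
    using le by (intro Limsup_mono) simp
  \<comment> \<open>Subadditivity of limsup holds here without excluding infinite values, because
    \<infinity> + (-\<infinity>) = \<infinity> in \<open>ereal\<close>.\<close>
  also have "\<dots> \<le> limsup (\<lambda>n. ereal t * ereal (h \<mu> n) + ereal (1 - t) * ereal (h \<rho> n))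
      + limsup (\<lambda>n. ereal (c / real n))"
    by (rule ereal_limsup_add_mono)
  also have "\<dots> = limsup (\<lambda>n. ereal t * ereal (h \<mu> n) + ereal (1 - t) * ereal (h \<rho> n))"
    by (simp only: c0 add_0_right)
  also have "\<dots> \<le> limsup (\<lambda>n. ereal t * ereal (h \<mu> n))
      + limsup (\<lambda>n. ereal (1 - t) * ereal (h \<rho> n))"
    by (rule ereal_limsup_add_mono)
  also have "\<dots> = ereal t * limsup (\<lambda>n. ereal (h \<mu> n))
      + ereal (1 - t) * limsup (\<lambda>n. ereal (h \<rho> n))"
    using assms(5,6) by (simp only: limsup_ereal_cmult diff_ge_0_iff_ge)
  finally show ?thesis by (simp only: ip)
qed

theorem proposition2p5:
  fixes M :: "'a measure" and \<mu> \<rho> :: "(nat \<Rightarrow> 'a) measure" and t :: real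
  assumes "prob_space \<mu>" and "sets \<mu> = sets (seq_space M)"
    and "prob_space \<rho>" and "sets \<rho> = sets (seq_space M)"
    and "0 \<le> t" and "t \<le> 1"
  shows "ip_entropy M (convex_mix t \<mu> \<rho>)
    \<le> ereal t * ip_entropy M \<mu> + ereal (1 - t) * ip_entropy M \<rho>"
  \<comment> \<open>Only the supremum on the left is opened: the mixture is bounded for each fixed
    \<open>P\<close>, and the suprema on the right serve as upper bounds for the values at that same
    \<open>P\<close>.\<close>
  unfolding ip_entropy_def[of M "convex_mix t \<mu> \<rho>"]
proof (rule SUP_least)
  fix P assume "P \<in> {P. finite_partition M P}"
  then have P: "finite_partition M P" by simp
  have le: "ip_entropy_partition M \<nu> P \<le> ip_entropy M \<nu>" for \<nu>
    unfolding ip_entropy_def using P by (auto intro: SUP_upper)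
  have "ip_entropy_partition M (convex_mix t \<mu> \<rho>) P
      \<le> ereal t * ip_entropy_partition M \<mu> P + ereal (1 - t) * ip_entropy_partition M \<rho> P"
    using assms P by (rule ip_entropy_partition_convex_mix_le)
  also have "\<dots> \<le> ereal t * ip_entropy M \<mu> + ereal (1 - t) * ip_entropy M \<rho>"
    using assms(5,6) by (intro add_mono ereal_mult_left_mono le) auto
  finally show "ip_entropy_partition M (convex_mix t \<mu> \<rho>) P
      \<le> ereal t * ip_entropy M \<mu> + ereal (1 - t) * ip_entropy M \<rho>" .
qed

end
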